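(* \[ \lim_{n\to\infty} \frac{\gamma^*_e(\S_n)}{n^2} \le \frac{1}{19}. \]
   Context: For vertices $u,v$ of a graph $G$, $\dist(u,v)$ is the length of a shortest $uv$ path and $w^*(u,v) = 2^{1-\dist(u,v)}$. A set $D \subseteq V(G)$ is a porous exponential dominating set if $\sum_{d \in D} w^*(d,v) \ge 1$ for every $v \in V(G)$; the porous exponential domination number $\gamma^*_e(G)$ is the minimum cardinality of such a set. The Slant grid $\S_n$ is the Cartesian product $P_n \square P_n$ (vertex set $[n]\times[n]$, $(i,j)\sim(i',j')$ iff they agree in one coordinate and differ by $1$ in the other) together with the additional edges $(i,j) \sim (i+1,j+1)$ for $i,j \in [n-1]$. *)

theory Defs
  imports Complex_Main "HOL-Library.Extended_Nat"
begin

text \<open>Graphs are finite, simple and undirected: an edge is the two-element set of its ends.\<close>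

record 'a graph =
  verts :: "'a set"
  edges :: "'a set set"

definition is_path :: "'a graph \<Rightarrow> 'a \<Rightarrow> 'a list \<Rightarrow> 'a \<Rightarrow> bool" where
  "is_path G u p v \<longleftrightarrow>
     p \<noteq> [] \<and> hd p = u \<and> last p = v \<and> distinct p \<and> set p \<subseteq> verts G \<and>
     successively (\<lambda>x y. {x, y} \<in> edges G) p"

text \<open>The length of a path is its number of edges. The infimum of the empty set is \<open>\<infinity>\<close>, so
  vertices in different components are at distance \<open>\<infinity>\<close>.\<close>

definition graph_dist :: "'a graph \<Rightarrow> 'a \<Rightarrow> 'a \<Rightarrow> enat" where
  "graph_dist G u v = Inf {enat (length p - 1) | p. is_path G u p v}"

definition exp_weight :: "'a graph \<Rightarrow> 'a \<Rightarrow> 'a \<Rightarrow> real" where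
  "exp_weight G u v =
     (case graph_dist G u v of enat k \<Rightarrow> 2 powi (1 - int k) | \<infinity> \<Rightarrow> 0)"

definition porous_exp_dominating :: "'a graph \<Rightarrow> 'a set \<Rightarrow> bool" where
  "porous_exp_dominating G D \<longleftrightarrow>
     D \<subseteq> verts G \<and> (\<forall>v\<in>verts G. (\<Sum>d\<in>D. exp_weight G d v) \<ge> 1)"

text \<open>The minimum exists for every finite graph: since \<open>exp_weight G v v = 2\<close> for each vertex
  \<open>v\<close>, the whole vertex set is dominating.\<close>

definition porous_exp_dom_number :: "'a graph \<Rightarrow> nat" where
  "porous_exp_dom_number G = (LEAST k. \<exists>D. porous_exp_dominating G D \<and> card D = k)"

definition path_graph :: "nat \<Rightarrow> nat graph" where
  "path_graph n = \<lparr>verts = {1..n}, edges = {{i, i + 1} | i. i \<in> {1..n - 1}}\<rparr>"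

definition cartesian_product :: "'a graph \<Rightarrow> 'b graph \<Rightarrow> ('a \<times> 'b) graph" where
  "cartesian_product G H =
     \<lparr>verts = verts G \<times> verts H,
      edges = {{(a, x), (a, y)} | a x y. a \<in> verts G \<and> {x, y} \<in> edges H} \<union>
              {{(a, x), (b, x)} | a b x. {a, b} \<in> edges G \<and> x \<in> verts H}\<rparr>"

definition slant_grid :: "nat \<Rightarrow> (nat \<times> nat) graph" where
  "slant_grid n =
     (let P = cartesian_product (path_graph n) (path_graph n) in
      \<lparr>verts = verts P,
       edges = edges P \<union>
         {{(i, j), (i + 1, j + 1)} | i j. i \<in> {1..n - 1} \<and> j \<in> {1..n - 1}}\<rparr>)"

end

theory Submission
  imports Defs
begin

text \<open>Distances in the slant grid are those of the triangular lattice,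
  \<open>max(|a|, |b|, |a - b|)\<close> for a displacement \<open>(a, b)\<close>, and a ball of radius 2 there has
  \<open>1 + 6 + 12 = 19\<close> points. The sublattice \<open>i + 7 j \<equiv> 0 (mod 19)\<close> is a perfect code of radius 2,
  and the code points within distance 4 of a vertex already give it weight at least 1. In a finite
  grid it suffices to add a boundary strip of width 4, which costs only \<open>O(n)\<close> vertices.

  The limit exists because the density is almost subadditive: tiling a large grid by
  \<open>n \<times> n\<close> blocks with optimal sets, and filling the leftover strip, gives
  \<open>\<gamma>(N)/N\<^sup>2 \<le> \<gamma>(n)/n\<^sup>2 + 2n/N\<close>. So the limit is the infimum.\<close>

section \<open>Distance and weight in an arbitrary graph\<close>

lemma graph_dist_le: "is_path G u p v \<Longrightarrow> graph_dist G u v \<le> enat (length p - 1)"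
  unfolding graph_dist_def by (rule Inf_lower) blast

text \<open>A finite value rules out the empty infimum, and a nonempty set of extended naturals
  attains its infimum, so a shortest path exists.\<close>

lemma graph_dist_enatE:
  assumes "graph_dist G u v = enat k"
  obtains p where "is_path G u p v" "length p - 1 = k"
proof -
  let ?S = "{enat (length p - 1) | p. is_path G u p v}"
  have "?S \<noteq> {}"
    using assms by (auto simp: graph_dist_def Inf_enat_def split: if_splits)
  then have "Inf ?S \<in> ?S"
    unfolding Inf_enat_def by (metis (mono_tags, lifting) LeastI ex_in_conv)
  then show thesis
    using that assms unfolding graph_dist_def by auto
qed

lemma graph_dist_refl: "v \<in> verts G \<Longrightarrow> graph_dist G v v = 0"
  using graph_dist_le[of G v "[v]" v] by (simp add: is_path_def zero_enat_def[symmetric])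

text \<open>Paths must have distinct vertices, so a shortest path to \<open>v\<close> can be
  extended by \<open>w\<close> only if it avoids \<open>w\<close>. Otherwise its initial segment
  ending at \<open>w\<close> is already short enough.\<close>

lemma graph_dist_step:
  assumes d: "graph_dist G u v \<le> enat k" and w: "w \<in> verts G" and e: "{v, w} \<in> edges G"
  shows "graph_dist G u w \<le> enat (Suc k)"
proof -
  obtain l where l: "graph_dist G u v = enat l" "l \<le> k"
    using d by (cases "graph_dist G u v") auto
  obtain p where p: "is_path G u p v" "length p - 1 = l"
    using l(1) by (rule graph_dist_enatE)
  show ?thesis
  proof (cases "w \<in> set p")
    case True
    then obtain xs ys where ps: "p = xs @ w # ys" by (meson split_list)
    have "is_path G u (xs @ [w]) w"
      using p(1) unfolding is_path_def ps by (auto simp: successively_append_iff hd_append)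
    from graph_dist_le[OF this] have "graph_dist G u w \<le> enat (length xs)" by simp
    also have "\<dots> \<le> enat (Suc k)" using p(2) l(2) ps by simp
    finally show ?thesis .
  next
    case False
    have "is_path G u (p @ [w]) w"
      using p(1) False w e unfolding is_path_def by (auto simp: successively_append_iff)
    from graph_dist_le[OF this] have "graph_dist G u w \<le> enat (length p)" by simp
    also have "\<dots> \<le> enat (Suc k)" using p(2) l(2) by simp
    finally show ?thesis .
  qed
qed

lemma exp_weight_nonneg: "0 \<le> exp_weight G u v"
  by (simp add: exp_weight_def split: enat.split)

lemma exp_weight_refl: "v \<in> verts G \<Longrightarrow> exp_weight G v v = 2"
  by (simp add: exp_weight_def graph_dist_refl zero_enat_def)

lemma exp_weight_ge:
  assumes "graph_dist G u v \<le> enat k"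
  shows "2 powi (1 - int k) \<le> exp_weight G u v"
proof -
  obtain l where "graph_dist G u v = enat l" "l \<le> k"
    using assms by (cases "graph_dist G u v") auto
  then show ?thesis
    by (auto simp: exp_weight_def intro!: power_int_increasing)
qed

text \<open>The image of a shortest path is again a path: injectivity keeps its vertices distinct.
  Distances therefore cannot grow and weights cannot drop; at infinite distance the left side is
  0.\<close>

lemma exp_weight_embedding:
  assumes inj: "inj_on f (verts G)" and V: "f ` verts G \<subseteq> verts H"
    and E: "\<And>x y. x \<in> verts G \<Longrightarrow> y \<in> verts G \<Longrightarrow> {x, y} \<in> edges G \<Longrightarrow> {f x, f y} \<in> edges H"
  shows "exp_weight G u v \<le> exp_weight H (f u) (f v)"
proof (cases "graph_dist G u v")
  case (enat k)
  obtain p where p: "is_path G u p v" "length p - 1 = k"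
    using enat by (rule graph_dist_enatE)
  have "successively (\<lambda>x y. {f x, f y} \<in> edges H) p"
    using p(1) unfolding is_path_def by (auto intro: successively_mono E)
  then have "is_path H (f u) (map f p) (f v)"
    using p(1) V inj unfolding is_path_def
    by (auto simp: hd_map last_map distinct_map successively_map inj_on_subset)
  from exp_weight_ge[OF graph_dist_le[OF this]] show ?thesis
    using enat p(2) by (simp add: exp_weight_def)
qed (simp add: exp_weight_nonneg exp_weight_def[of G])

section \<open>The domination number\<close>

lemma porous_exp_dom_number_le:
  "porous_exp_dominating G D \<Longrightarrow> porous_exp_dom_number G \<le> card D"
  unfolding porous_exp_dom_number_def by (rule Least_le) blast

text \<open>A vertex gives itself weight 2 and no weight is negative. This settles every vertex of a
  strip that is put into the dominating set as a whole.\<close>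

lemma sum_exp_weight_ge_1_member:
  assumes "finite D" "v \<in> D" "v \<in> verts G"
  shows "1 \<le> (\<Sum>d\<in>D. exp_weight G d v)"
proof -
  have "exp_weight G v v \<le> (\<Sum>d\<in>D. exp_weight G d v)"
    using assms by (intro member_le_sum exp_weight_nonneg) auto
  then show ?thesis using assms by (simp add: exp_weight_refl)
qed

lemma minimum_porous_exp_dominating:
  assumes "finite (verts G)"
  obtains D where "porous_exp_dominating G D" "card D = porous_exp_dom_number G"
proof -
  have "porous_exp_dominating G (verts G)"
    using assms by (auto simp: porous_exp_dominating_def intro: sum_exp_weight_ge_1_member)
  then have "\<exists>k D. porous_exp_dominating G D \<and> card D = k" by blast
  from LeastI_ex[OF this] show thesis
    using that unfolding porous_exp_dom_number_def by blast
qed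

section \<open>Edges and distances of the slant grid\<close>

lemma verts_slant_grid: "verts (slant_grid n) = {1..n} \<times> {1..n}"
  by (simp add: slant_grid_def cartesian_product_def path_graph_def)

definition slant_step :: "nat \<times> nat \<Rightarrow> nat \<times> nat \<Rightarrow> bool" where
  "slant_step u v \<longleftrightarrow>
     (fst v = fst u + 1 \<and> snd v = snd u) \<or> (fst v = fst u \<and> snd v = snd u + 1) \<or>
     (fst v = fst u + 1 \<and> snd v = snd u + 1)"

text \<open>The row, column and diagonal edges are treated as three separate families, because an
  unordered pair can match each of them in two orders.\<close>

lemma edge_slant_grid_iff:
  "{u, v} \<in> edges (slant_grid n) \<longleftrightarrow>
     u \<in> {1..n} \<times> {1..n} \<and> v \<in> {1..n} \<times> {1..n} \<and> (slant_step u v \<or> slant_step v u)"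
proof -
  let ?P = "edges (path_graph n)"
  have P: "{x, y} \<in> ?P \<longleftrightarrow> x \<in> {1..n} \<and> y \<in> {1..n} \<and> (y = x + 1 \<or> x = y + 1)" for x y
    by (auto simp: path_graph_def doubleton_eq_iff)
  obtain a b c d where uv: "u = (a, b)" "v = (c, d)" by fastforce
  have "{(a, b), (c, d)} \<in> {{(e, x), (e, y)} | e x y. e \<in> {1..n} \<and> {x, y} \<in> ?P} \<longleftrightarrow>
      a = c \<and> a \<in> {1..n} \<and> {b, d} \<in> ?P"
    unfolding mem_Collect_eq doubleton_eq_iff prod.inject by (metis insert_commute)
  moreover have "{(a, b), (c, d)} \<in> {{(e, x), (f, x)} | e f x. {e, f} \<in> ?P \<and> x \<in> {1..n}} \<longleftrightarrow>
      b = d \<and> b \<in> {1..n} \<and> {a, c} \<in> ?P"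
    unfolding mem_Collect_eq doubleton_eq_iff prod.inject by (metis insert_commute)
  moreover have "{(a, b), (c, d)} \<in>
        {{(i, j), (i + 1, j + 1)} | i j. i \<in> {1..n - 1} \<and> j \<in> {1..n - 1}} \<longleftrightarrow>
      a \<in> {1..n} \<and> b \<in> {1..n} \<and> c \<in> {1..n} \<and> d \<in> {1..n} \<and>
      (c = a + 1 \<and> d = b + 1 \<or> a = c + 1 \<and> b = d + 1)"
    unfolding mem_Collect_eq doubleton_eq_iff prod.inject conj_disj_distribR ex_disj_distrib
    by auto
  moreover have "edges (slant_grid n) =
      {{(e, x), (e, y)} | e x y. e \<in> {1..n} \<and> {x, y} \<in> ?P} \<union>
      {{(e, x), (f, x)} | e f x. {e, f} \<in> ?P \<and> x \<in> {1..n}} \<union>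
      {{(i, j), (i + 1, j + 1)} | i j. i \<in> {1..n - 1} \<and> j \<in> {1..n - 1}}"
    by (simp add: slant_grid_def cartesian_product_def Let_def) (simp add: path_graph_def)
  ultimately have "{u, v} \<in> edges (slant_grid n) \<longleftrightarrow>
      (a = c \<and> a \<in> {1..n} \<and> {b, d} \<in> ?P) \<or> (b = d \<and> b \<in> {1..n} \<and> {a, c} \<in> ?P) \<or>
      (a \<in> {1..n} \<and> b \<in> {1..n} \<and> c \<in> {1..n} \<and> d \<in> {1..n} \<and>
        (c = a + 1 \<and> d = b + 1 \<or> a = c + 1 \<and> b = d + 1))"
    unfolding uv by (simp only: Un_iff disj_assoc)
  then show ?thesis
    unfolding P uv by (auto simp: slant_step_def)
qed

text \<open>Induction on \<open>k\<close>, moving the target one edge towards \<open>(i, j)\<close>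
  inside the box spanned by the two points, hence inside the grid.\<close>

lemma graph_dist_slant_grid_le:
  assumes "(i, j) \<in> {1..n} \<times> {1..n}" "(i', j') \<in> {1..n} \<times> {1..n}"
    and "\<bar>int i' - int i\<bar> \<le> int k" "\<bar>int j' - int j\<bar> \<le> int k"
      "\<bar>(int i' - int i) - (int j' - int j)\<bar> \<le> int k"
  shows "graph_dist (slant_grid n) (i, j) (i', j') \<le> enat k"
  using assms
proof (induction k arbitrary: i' j')
  case 0
  then have "i' = i" "j' = j" by auto
  then show ?case using 0 by (simp add: graph_dist_refl verts_slant_grid zero_enat_def[symmetric])
next
  case (Suc k)
  \<comment> \<open>If both displacements have the same sign, the step is diagonal. If the signs are
    opposite, only the first coordinate moves: this lowers the absolute difference of the
    displacements, which is then the largest of the three quantities.\<close>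
  define x where "x = (if i' > i then i' - 1 else if i' < i then i' + 1 else i')"
  define y where "y = (if j' > j \<and> i' \<ge> i then j' - 1 else if j' < j \<and> i' \<le> i then j' + 1 else j')"
  show ?case
  proof (cases "(x, y) = (i', j')")
    case True
    then have "(i', j') = (i, j)" by (auto simp: x_def y_def split: if_splits)
    then show ?thesis using Suc.prems(1)
      by (simp add: graph_dist_refl verts_slant_grid)
  next
    case False
    have "graph_dist (slant_grid n) (i, j) (x, y) \<le> enat k"
      using Suc.prems by (intro Suc.IH) (auto simp: x_def y_def split: if_splits)
    moreover have "{(x, y), (i', j')} \<in> edges (slant_grid n)"
      using Suc.prems False by (auto simp: edge_slant_grid_iff slant_step_def x_def y_def split: if_splits)
    ultimately show ?thesis
      using Suc.prems(2) by (intro graph_dist_step) (auto simp: verts_slant_grid)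
  qed
qed


section \<open>Translation, tiling and almost subadditive density\<close>

lemma exp_weight_slant_grid_shift:
  assumes "n + a \<le> N" "n + b \<le> N"
  shows "exp_weight (slant_grid n) u v \<le>
    exp_weight (slant_grid N) (map_prod ((+) a) ((+) b) u) (map_prod ((+) a) ((+) b) v)"
  by (rule exp_weight_embedding)
    (use assms in \<open>auto simp: inj_on_def verts_slant_grid edge_slant_grid_iff slant_step_def\<close>)

text \<open>Each of the \<open>k * k\<close> blocks of side \<open>n\<close> receives a translate of
  an optimal set and is dominated by it alone; weight arriving from other blocks only helps. The
  leftover strips are taken whole.\<close>

lemma porous_exp_dom_number_slant_grid_tiling:
  fixes k n r :: nat
  defines "N \<equiv> k * n + r"
  assumes n: "n \<ge> 1"
  shows "porous_exp_dom_number (slant_grid N) \<le>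
    k\<^sup>2 * porous_exp_dom_number (slant_grid n) + 2 * r * N"
proof -
  obtain D where D: "porous_exp_dominating (slant_grid n) D"
      and cardD: "card D = porous_exp_dom_number (slant_grid n)"
    using minimum_porous_exp_dominating[of "slant_grid n"] by (auto simp: verts_slant_grid)
  have DV: "D \<subseteq> {1..n} \<times> {1..n}" and dom: "\<And>v. v \<in> {1..n} \<times> {1..n} \<Longrightarrow>
      1 \<le> (\<Sum>d\<in>D. exp_weight (slant_grid n) d v)"
    using D by (auto simp: porous_exp_dominating_def verts_slant_grid)
  have finD: "finite D" using DV by (rule finite_subset) simp
  define f :: "nat \<times> nat \<Rightarrow> nat \<times> nat \<Rightarrow> nat \<times> nat"
    where "f = (\<lambda>(p, q). map_prod ((+) (p * n)) ((+) (q * n)))"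
  define T where "T = (\<Union>pq\<in>{..<k} \<times> {..<k}. f pq ` D)"
  \<comment> \<open>An L-shaped region, covered by two strips of size \<open>r\<close> by
    \<open>N\<close>.\<close>
  define S where "S = {k * n<..N} \<times> {1..N} \<union> {1..N} \<times> {k * n<..N}"
  have block: "n + p * n \<le> N" if "p < k" for p
    using mult_le_mono1[of "Suc p" k n] that by (simp add: N_def)
  have finT: "finite T" and finS: "finite S" using finD by (auto simp: T_def S_def)
  have "card (T \<union> S) \<le> card T + card S" by (rule card_Un_le)
  also have "card T \<le> (\<Sum>pq\<in>{..<k} \<times> {..<k}. card (f pq ` D))"
    unfolding T_def by (rule card_UN_le) simp
  also have "\<dots> \<le> (\<Sum>pq\<in>{..<k} \<times> {..<k}. card D)"
    by (intro sum_mono card_image_le finD)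
  also have "\<dots> = k\<^sup>2 * porous_exp_dom_number (slant_grid n)"
    by (simp add: cardD power2_eq_square)
  also have "card S \<le> 2 * r * N"
    unfolding S_def by (rule order.trans[OF card_Un_le]) (simp add: N_def)
  finally have card: "card (T \<union> S) \<le> k\<^sup>2 * porous_exp_dom_number (slant_grid n) + 2 * r * N"
    by simp
  have "porous_exp_dominating (slant_grid N) (T \<union> S)"
    unfolding porous_exp_dominating_def verts_slant_grid
  proof (intro conjI ballI)
    have "f pq ` D \<subseteq> {1..N} \<times> {1..N}" if "pq \<in> {..<k} \<times> {..<k}" for pq
      using that DV block[of "fst pq"] block[of "snd pq"] by (fastforce simp: f_def)
    then show "T \<union> S \<subseteq> {1..N} \<times> {1..N}"
      unfolding T_def S_def by auto
  next
    fix v assume v: "v \<in> {1..N} \<times> {1..N}"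
    show "1 \<le> (\<Sum>d\<in>T \<union> S. exp_weight (slant_grid N) d v)"
    proof (cases "v \<in> S")
      case True
      then show ?thesis using v finT finS
        by (intro sum_exp_weight_ge_1_member) (auto simp: verts_slant_grid)
    next
      case False
      obtain i j where ij: "v = (i, j)" by fastforce
      have le: "1 \<le> i" "i \<le> k * n" "1 \<le> j" "j \<le> k * n"
        using v False by (auto simp: ij S_def)
      \<comment> \<open>Coordinates start at 1, so block index and position in the block come from
        \<open>i - 1\<close> and \<open>j - 1\<close>, and 1 is added back to the position.\<close>
      define p where "p = (i - 1) div n"
      define q where "q = (j - 1) div n"
      define w where "w = ((i - 1) mod n + 1, (j - 1) mod n + 1)"
      have pq: "p < k" "q < k"
        using le n by (auto simp: p_def q_def less_mult_imp_div_less)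
      have w: "w \<in> {1..n} \<times> {1..n}"
        using n by (auto simp: w_def Suc_le_eq)
      have fw: "f (p, q) w = v"
        using le by (simp add: f_def w_def ij p_def q_def)
      have inj: "inj_on (f (p, q)) D" by (auto simp: f_def inj_on_def)
      have "1 \<le> (\<Sum>d\<in>D. exp_weight (slant_grid n) d w)" by (rule dom[OF w])
      also have "\<dots> \<le> (\<Sum>d\<in>D. exp_weight (slant_grid N) (f (p, q) d) (f (p, q) w))"
        unfolding f_def prod.case
        by (intro sum_mono exp_weight_slant_grid_shift block pq)
      also have "\<dots> = (\<Sum>d\<in>f (p, q) ` D. exp_weight (slant_grid N) d v)"
        by (simp add: sum.reindex[OF inj] fw)
      also have "\<dots> \<le> (\<Sum>d\<in>T \<union> S. exp_weight (slant_grid N) d v)"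
        using pq finT finS by (intro sum_mono2 exp_weight_nonneg) (auto simp: T_def)
      finally show ?thesis .
    qed
  qed
  from porous_exp_dom_number_le[OF this] card show ?thesis by linarith
qed

text \<open>Division with remainder, \<open>N = k * n + r\<close>, feeds the tiling bound; then
  \<open>r\<close> is below \<open>n\<close> and \<open>k / N\<close> is at most
  \<open>1 / n\<close>.\<close>

lemma porous_exp_dom_density_slant_grid_le:
  fixes n N :: nat
  assumes "n \<ge> 1" "N \<ge> 1"
  shows "real (porous_exp_dom_number (slant_grid N)) / (real N)\<^sup>2 \<le>
    real (porous_exp_dom_number (slant_grid n)) / (real n)\<^sup>2 + 2 * real n / real N"
proof -
  let ?g = "\<lambda>n. porous_exp_dom_number (slant_grid n)"
  define k r where "k = N div n" and "r = N mod n"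
  have N: "N = k * n + r" by (simp add: k_def r_def)
  have "?g N \<le> k\<^sup>2 * ?g n + 2 * r * N"
    using porous_exp_dom_number_slant_grid_tiling[OF assms(1), of k r] by (simp add: N)
  also have "\<dots> \<le> k\<^sup>2 * ?g n + 2 * n * N"
    using assms(1) by (intro add_mono mult_mono) (auto simp: r_def less_imp_le)
  finally have "real (?g N) \<le> real (k\<^sup>2 * ?g n + 2 * n * N)" by (rule of_nat_mono)
  then have "real (?g N) / (real N)\<^sup>2 \<le> real (k\<^sup>2 * ?g n + 2 * n * N) / (real N)\<^sup>2"
    by (intro divide_right_mono) auto
  also have "\<dots> = (real k / real N)\<^sup>2 * ?g n + 2 * real n / real N"
    using assms by (simp add: add_divide_distrib power_divide power2_eq_square)
  also have "(real k / real N)\<^sup>2 \<le> (1 / real n)\<^sup>2"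
  proof (intro power_mono)
    have "real (k * n) \<le> real N" unfolding N by (intro of_nat_mono) simp
    then show "real k / real N \<le> 1 / real n" using assms by (simp add: field_simps)
  qed auto
  finally show ?thesis by (simp add: power_divide mult_right_mono)
qed

section \<open>The perfect code modulo 19\<close>

definition hex_norm :: "int \<times> int \<Rightarrow> nat" where
  "hex_norm = (\<lambda>(a, b). nat (max \<bar>a\<bar> (max \<bar>b\<bar> \<bar>a - b\<bar>)))"

lemma le_hex_norm:
  "\<bar>a\<bar> \<le> int (hex_norm (a, b))" "\<bar>b\<bar> \<le> int (hex_norm (a, b))" "\<bar>a - b\<bar> \<le> int (hex_norm (a, b))"
  by (auto simp: hex_norm_def le_max_iff_disj)

text \<open>The code is \<open>{(i, j). i + 7 j \<equiv> 0 (mod 19)}\<close>; \<open>code_offsets s\<close> lists the displacements to code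
  points from a vertex with \<open>i + 7 j \<equiv> s (mod 19)\<close>.\<close>

definition code_offsets :: "int \<Rightarrow> (int \<times> int) list" where
  "code_offsets s =
     filter (\<lambda>(a, b). (s + a + 7 * b) mod 19 = 0) (List.product [-4..4] [-4..4])"

lemma distinct_code_offsets: "distinct (code_offsets s)"
  unfolding code_offsets_def by (intro distinct_filter distinct_product distinct_upto)

lemma set_code_offsets:
  "set (code_offsets s) = {(a, b) \<in> {-4..4} \<times> {-4..4}. (s + a + 7 * b) mod 19 = 0}"
  unfolding code_offsets_def set_filter set_product set_upto by auto

text \<open>Both sides are scaled by \<open>2^7\<close>, as \<open>2^(1 - h) = 2^(8 - h) / 128\<close>.\<close>

lemma code_offsets_weight:
  assumes "0 \<le> s" "s < 19"
  shows "128 \<le> (\<Sum>ab\<in>set (code_offsets s). 2 ^ (8 - hex_norm ab) :: nat)"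
proof -
  \<comment> \<open>The weights depend only on the residue, which leaves nineteen finite sums to
    evaluate.\<close>
  have "\<forall>s\<in>set [0..18]. 128 \<le> (\<Sum>ab\<leftarrow>code_offsets s. 2 ^ (8 - hex_norm ab) :: nat)"
    by code_simp
  moreover have "s \<in> set [0..18]" using assms by simp
  ultimately show ?thesis
    unfolding sum_list_distinct_conv_sum_set[OF distinct_code_offsets] by blast
qed

text \<open>For fixed \<open>j\<close> the code meets each run of 19 consecutive \<open>i\<close> at
  most once, which gives at most \<open>m * N = 19 * m\<^sup>2\<close> code vertices. A frame of
  width 4 adds at most \<open>16 * N\<close>; away from it, all displacements in the window of
  \<open>code_offsets\<close> stay in the grid.\<close>

lemma porous_exp_dom_number_slant_grid_19:
  fixes m :: nat
  defines "N \<equiv> 19 * m"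
  shows "porous_exp_dom_number (slant_grid N) \<le> 19 * m\<^sup>2 + 16 * N"
proof -
  define C where "C = {(i, j) \<in> {1..N} \<times> {1..N}. (int i + 7 * int j) mod 19 = 0}"
  \<comment> \<open>Intersecting with \<open>{1..N}\<close> keeps \<open>B\<close> inside the grid
    also when \<open>m = 0\<close>.\<close>
  define B where "B = ({1..4} \<union> {N - 4<..N}) \<inter> {1..N}"
  define S where "S = B \<times> {1..N} \<union> {1..N} \<times> B"
  have finC: "finite C"
    by (rule finite_subset[of _ "{1..N} \<times> {1..N}"]) (auto simp: C_def)
  have finS: "finite S" by (simp add: S_def B_def)
  have "card C \<le> card ({..<m} \<times> {1..N})"
  proof (rule card_inj_on_le)
    \<comment> \<open>Code vertices with the same \<open>j\<close> have first coordinates congruent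
      modulo 19, so the index of the run of 19 determines the vertex.\<close>
    show "inj_on (map_prod (\<lambda>i. (i - 1) div 19) id) C"
    proof (rule inj_onI)
      fix x y
      assume xy: "x \<in> C" "y \<in> C"
        "map_prod (\<lambda>i. (i - 1) div 19) id x = map_prod (\<lambda>i. (i - 1) div 19) id y"
      then obtain i i' j where eq: "x = (i, j)" "y = (i', j)"
        by (cases x; cases y) auto
      have i: "Suc 0 \<le> i" "Suc 0 \<le> i'"
        and div_eq: "(i - Suc 0) div 19 = (i' - Suc 0) div 19"
        and "(int i + 7 * int j) mod 19 = 0" "(int i' + 7 * int j) mod 19 = 0"
        using xy by (auto simp: eq C_def)
      then have "(int i + 7 * int j) mod 19 = (int i' + 7 * int j) mod 19" by simp
      then have "int (i - Suc 0) mod 19 = int (i' - Suc 0) mod 19"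
        using i by (simp add: mod_eq_dvd_iff of_nat_diff)
      then have "(i - Suc 0) mod 19 = (i' - Suc 0) mod 19"
        by (metis of_nat_eq_iff of_nat_mod of_nat_numeral)
      with div_eq have "i - Suc 0 = i' - Suc 0" by (metis div_mult_mod_eq)
      then show "x = y" using i by (simp add: eq)
    qed
    show "map_prod (\<lambda>i. (i - 1) div 19) id ` C \<subseteq> {..<m} \<times> {1..N}"
      by (auto simp: C_def N_def)
  qed simp
  moreover have "card B \<le> 8"
  proof -
    have "card B \<le> card ({1..4} \<union> {N - 4<..N})" by (intro card_mono) (auto simp: B_def)
    also have "\<dots> \<le> card {1..4::nat} + card {N - 4<..N}" by (rule card_Un_le)
    finally show ?thesis by simp
  qed
  then have "card S \<le> 8 * N + N * 8"
    unfolding S_def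
    by (intro order.trans[OF card_Un_le] add_mono) (simp_all add: card_cartesian_product)
  ultimately have card: "card (C \<union> S) \<le> 19 * m\<^sup>2 + 16 * N"
    using card_Un_le[of C S] by (simp add: N_def power2_eq_square)
  have "porous_exp_dominating (slant_grid N) (C \<union> S)"
    unfolding porous_exp_dominating_def verts_slant_grid
  proof (intro conjI ballI)
    show "C \<union> S \<subseteq> {1..N} \<times> {1..N}" by (auto simp: C_def S_def B_def)
  next
    fix v assume v: "v \<in> {1..N} \<times> {1..N}"
    show "1 \<le> (\<Sum>d\<in>C \<union> S. exp_weight (slant_grid N) d v)"
    proof (cases "v \<in> S")
      case True
      then show ?thesis using v finC finS
        by (intro sum_exp_weight_ge_1_member) (auto simp: verts_slant_grid)
    next
      case False
      obtain i j where ij: "v = (i, j)" by fastforce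
      have bounds: "5 \<le> i" "i + 4 \<le> N" "5 \<le> j" "j + 4 \<le> N"
        using v False by (auto simp: ij S_def B_def)
      define s where "s = (int i + 7 * int j) mod 19"
      \<comment> \<open>\<open>nat\<close> does not truncate here: \<open>i\<close> and
        \<open>j\<close> are at least 5 and offsets at least -4.\<close>
      define f where "f = (\<lambda>(a, b). (nat (int i + a), nat (int j + b)))"
      have mem: "-4 \<le> a" "a \<le> 4" "-4 \<le> b" "b \<le> 4" "(int i + a + 7 * (int j + b)) mod 19 = 0"
        if "(a, b) \<in> set (code_offsets s)" for a b
      proof -
        have "(s + a + 7 * b) mod 19 = 0" using that by (simp add: set_code_offsets)
        moreover have "(s + a + 7 * b) mod 19 = (int i + 7 * int j + a + 7 * b) mod 19"
          unfolding s_def by (simp only: add.assoc mod_add_left_eq)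
        ultimately show "(int i + a + 7 * (int j + b)) mod 19 = 0"
          by (simp add: algebra_simps)
      qed (use that in \<open>auto simp: set_code_offsets\<close>)
      have inj: "inj_on f (set (code_offsets s))"
      proof (rule inj_onI)
        fix x y assume xy: "x \<in> set (code_offsets s)" "y \<in> set (code_offsets s)" "f x = f y"
        obtain a b a' b' where eq: "x = (a, b)" "y = (a', b')" by (metis surj_pair)
        have "nat (int i + a) = nat (int i + a')" "nat (int j + b) = nat (int j + b')"
          using xy(3) by (simp_all add: f_def eq)
        then have "a = a'" "b = b'"
          using mem(1,3)[OF xy(1)[unfolded eq]] mem(1,3)[OF xy(2)[unfolded eq]] bounds
          by linarith+
        then show "x = y" by (simp add: eq)
      qed
      have fC: "f ` set (code_offsets s) \<subseteq> C"
      proof (rule image_subsetI)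
        fix ab assume "ab \<in> set (code_offsets s)"
        then obtain a b where ab: "ab = (a, b)" "(a, b) \<in> set (code_offsets s)"
          by (metis surj_pair)
        show "f ab \<in> C"
          using mem[OF ab(2)] bounds by (auto simp: ab(1) f_def C_def)
      qed
      have "128 \<le> (\<Sum>ab\<in>set (code_offsets s). 2 ^ (8 - hex_norm ab) :: nat)"
        by (rule code_offsets_weight) (simp_all add: s_def)
      then have "128 \<le> real (\<Sum>ab\<in>set (code_offsets s). 2 ^ (8 - hex_norm ab) :: nat)"
        by linarith
      then have "1 \<le> (\<Sum>ab\<in>set (code_offsets s). 2 ^ (8 - hex_norm ab)) / (128::real)"
        by simp
      also have "\<dots> = (\<Sum>ab\<in>set (code_offsets s). 2 ^ (8 - hex_norm ab) / (128::real))"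
        by (rule sum_divide_distrib)
      also have "\<dots> \<le> (\<Sum>ab\<in>set (code_offsets s). exp_weight (slant_grid N) (f ab) v)"
      proof (rule sum_mono)
        fix ab assume "ab \<in> set (code_offsets s)"
        then obtain a b where ab: "ab = (a, b)" "(a, b) \<in> set (code_offsets s)"
          by (metis surj_pair)
        \<comment> \<open>Opposite signs in the window give norms up to 8, so the natural
          subtraction \<open>8 - hex_norm ab\<close> is exact.\<close>
        have h8: "hex_norm ab \<le> 8" using mem[OF ab(2)] by (auto simp: ab(1) hex_norm_def)
        have "graph_dist (slant_grid N) (f ab) v \<le> enat (hex_norm ab)"
          unfolding ij ab(1) f_def prod.case
        proof (rule graph_dist_slant_grid_le)
          have nat: "int (nat (int i + a)) = int i + a" "int (nat (int j + b)) = int j + b"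
            using mem[OF ab(2)] bounds by simp_all
          show "\<bar>int i - int (nat (int i + a))\<bar> \<le> int (hex_norm (a, b))"
            unfolding nat using le_hex_norm(1)[of a b] by linarith
          show "\<bar>int j - int (nat (int j + b))\<bar> \<le> int (hex_norm (a, b))"
            unfolding nat using le_hex_norm(2)[of b a] by linarith
          show "\<bar>int i - int (nat (int i + a)) - (int j - int (nat (int j + b)))\<bar>
              \<le> int (hex_norm (a, b))"
            unfolding nat using le_hex_norm(3)[of a b] by linarith
        qed (use mem[OF ab(2)] bounds in auto)
        then have "2 powi (1 - int (hex_norm ab)) \<le> exp_weight (slant_grid N) (f ab) v"
          by (rule exp_weight_ge)
        moreover have eq: "1 - int (hex_norm ab) = int (8 - hex_norm ab) - int 7"
          using h8 by simp
        have "2 ^ (8 - hex_norm ab) / (128::real) = 2 powi (1 - int (hex_norm ab))"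
          unfolding eq by (subst power_int_diff) (simp_all only: power_int_of_nat, simp_all)
        ultimately show "2 ^ (8 - hex_norm ab) / (128::real) \<le> exp_weight (slant_grid N) (f ab) v"
          by (simp only:)
      qed
      also have "\<dots> = (\<Sum>d\<in>f ` set (code_offsets s). exp_weight (slant_grid N) d v)"
        by (simp add: sum.reindex[OF inj])
      also have "\<dots> \<le> (\<Sum>d\<in>C \<union> S. exp_weight (slant_grid N) d v)"
        using fC finC finS by (intro sum_mono2 exp_weight_nonneg) auto
      finally show ?thesis .
    qed
  qed
  from porous_exp_dom_number_le[OF this] card show ?thesis by linarith
qed

section \<open>Existence of the limit and its bound\<close>

text \<open>A Fekete-type argument: fix \<open>n\<close> with \<open>a n\<close> close to the
  infimum and let \<open>N\<close> grow, so that the error term vanishes. Index 0 is left out of the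
  infimum, since the density there is \<open>0 / 0 = 0\<close> and would pull it down to 0.\<close>

lemma convergent_to_Inf:
  fixes a :: "nat \<Rightarrow> real"
  assumes nonneg: "\<And>n. 0 \<le> a n"
    and le: "\<And>n N. n \<ge> 1 \<Longrightarrow> N \<ge> 1 \<Longrightarrow> a N \<le> a n + c * real n / real N"
  shows "a \<longlonglongrightarrow> Inf (a ` {1..})"
proof (rule order_tendstoI)
  have bdd: "bdd_below (a ` {1..})" using nonneg by (intro bdd_belowI[of _ 0]) auto
  show "\<forall>\<^sub>F N in sequentially. y < a N" if y: "y < Inf (a ` {1..})" for y
  proof (rule eventually_sequentiallyI[of 1])
    fix N :: nat assume "1 \<le> N"
    then have "Inf (a ` {1..}) \<le> a N" by (intro cINF_lower[OF bdd]) simp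
    with y show "y < a N" by linarith
  qed
  show "\<forall>\<^sub>F N in sequentially. a N < y" if y: "Inf (a ` {1..}) < y" for y
  proof -
    obtain n where n: "n \<ge> 1" "a n < y"
      using y cInf_less_iff[OF _ bdd, of y] by auto
    have "(\<lambda>N. a n + c * real n / real N) \<longlonglongrightarrow> a n + 0"
      by (intro tendsto_intros lim_const_over_n)
    then have "\<forall>\<^sub>F N in sequentially. a n + c * real n / real N < y"
      using n(2) by (intro order_tendstoD) auto
    then show ?thesis
      using eventually_ge_at_top[of 1] by eventually_elim (use le[OF n(1)] in fastforce)
  qed
qed

theorem theorem3p6:
  "\<exists>L::real. (\<lambda>n. real (porous_exp_dom_number (slant_grid n)) / (real n)\<^sup>2) \<longlonglongrightarrow> L \<and> L \<le> 1 / 19"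
proof (intro exI conjI)
  let ?a = "\<lambda>n. real (porous_exp_dom_number (slant_grid n)) / (real n)\<^sup>2"
  show lim: "?a \<longlonglongrightarrow> Inf (?a ` {1..})"
    using porous_exp_dom_density_slant_grid_le by (intro convergent_to_Inf[where c = 2]) auto
  have "?a (19 * m) \<le> 1 / 19 + (16 / 19) / real m" if "m \<ge> 1" for m
  proof -
    have "real (porous_exp_dom_number (slant_grid (19 * m))) \<le> real (19 * m\<^sup>2 + 16 * (19 * m))"
      by (rule of_nat_mono[OF porous_exp_dom_number_slant_grid_19])
    then show ?thesis using that by (simp add: field_simps power2_eq_square)
  qed
  then have "\<forall>\<^sub>F m in sequentially. ?a (19 * m) \<le> 1 / 19 + (16 / 19) / real m"
    by (intro eventually_sequentiallyI)
  \<comment> \<open>As the whole sequence converges, its limit can be read off along the multiples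
    of 19.\<close>
  moreover have "(\<lambda>m. ?a (19 * m)) \<longlonglongrightarrow> Inf (?a ` {1..})"
    using lim by (rule LIMSEQ_subseq_LIMSEQ[unfolded o_def]) (simp add: strict_mono_def)
  moreover have "(\<lambda>m. 1 / 19 + (16 / 19) / real m) \<longlonglongrightarrow> 1 / 19 + 0"
    by (intro tendsto_intros lim_const_over_n)
  ultimately show "Inf (?a ` {1..}) \<le> 1 / 19"
    using tendsto_le[OF sequentially_bot] by force
qed

end
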